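(* Let $n\ge1$, and for $1\le k\le n$ let $$G_k=\begin{bmatrix}I_{k-1}&0&0&0\\0&\alpha_k&\beta_k&0\\0&\gamma_k&\delta_k&0\\0&0&0&I_{n-k}\end{bmatrix}\in\mathbb C^{(n+1)\times(n+1)},\qquad \alpha_k,\beta_k,\gamma_k,\delta_k\in\mathbb C.$$ Let $A,D\in\mathbb C^{(n+1)\times(n+1)}$ be diagonal matrices and, for a permutation $\pi=(\pi_1,\dots,\pi_n)$ of $(1,\dots,n)$, let $M_\pi=G_{\pi_1}G_{\pi_2}\cdots G_{\pi_n}$. Then the determinant, and hence also the eigenvalues, of the matrix $AM_\pi+D$ do not depend on the permutation $\pi$.
   Context: $I_m$ denotes the $m\times m$ identity matrix ($I_0$ is the empty matrix). A matrix of the form $AM_\pi+D$ as in the claim is called an AMPD matrix. *)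

theory Defs
  imports "Jordan_Normal_Form.Char_Poly" "HOL-Combinatorics.Permutations"
begin

text \<open>The \<open>k\<close>-th matrix only has its intended size \<open>n + 1\<close> for \<open>1 \<le> k \<le> n\<close>;
  the parameter families \<open>\<alpha> \<beta> \<gamma> \<delta>\<close> are only read at such indices.\<close>

definition G_mat ::
  "nat \<Rightarrow> (nat \<Rightarrow> complex) \<Rightarrow> (nat \<Rightarrow> complex) \<Rightarrow> (nat \<Rightarrow> complex) \<Rightarrow> (nat \<Rightarrow> complex)
    \<Rightarrow> nat \<Rightarrow> complex mat"
where
  "G_mat n \<alpha> \<beta> \<gamma> \<delta> k = diag_block_mat
     [1\<^sub>m (k - 1),
      mat_of_rows_list 2 [[\<alpha> k, \<beta> k], [\<gamma> k, \<delta> k]],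
      1\<^sub>m (n - k)]"

text \<open>The permutation \<open>(\<pi> 1, \<dots>, \<pi> n)\<close> is a function with \<open>\<pi> permutes {1..n}\<close>, and the
  product is taken in the order \<open>\<pi> 1, \<dots>, \<pi> n\<close> from left to right.\<close>

definition M_mat ::
  "nat \<Rightarrow> (nat \<Rightarrow> complex) \<Rightarrow> (nat \<Rightarrow> complex) \<Rightarrow> (nat \<Rightarrow> complex) \<Rightarrow> (nat \<Rightarrow> complex)
    \<Rightarrow> (nat \<Rightarrow> nat) \<Rightarrow> complex mat"
where
  "M_mat n \<alpha> \<beta> \<gamma> \<delta> \<pi> =
     foldr (\<lambda>i P. G_mat n \<alpha> \<beta> \<gamma> \<delta> (\<pi> i) * P) [1..<n + 1] (1\<^sub>m (n + 1))"

definition AMPD_mat ::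
  "nat \<Rightarrow> complex mat \<Rightarrow> complex mat
    \<Rightarrow> (nat \<Rightarrow> complex) \<Rightarrow> (nat \<Rightarrow> complex) \<Rightarrow> (nat \<Rightarrow> complex) \<Rightarrow> (nat \<Rightarrow> complex)
    \<Rightarrow> (nat \<Rightarrow> nat) \<Rightarrow> complex mat"
where
  "AMPD_mat n A D \<alpha> \<beta> \<gamma> \<delta> \<pi> = A * M_mat n \<alpha> \<beta> \<gamma> \<delta> \<pi> + D"

lemma G_mat_carrier:
  assumes "1 \<le> k" "k \<le> n"
  shows "G_mat n \<alpha> \<beta> \<gamma> \<delta> k \<in> carrier_mat (n + 1) (n + 1)"
  using assms by (auto simp: G_mat_def Let_def mat_of_rows_list_def)

text \<open>The entries of the block matrix, with rows and columns counted from \<open>0\<close>.\<close>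

lemma G_mat_index:
  assumes "1 \<le> k" "k \<le> n" "i < n + 1" "j < n + 1"
  shows "G_mat n \<alpha> \<beta> \<gamma> \<delta> k $$ (i, j) =
    (if i = k - 1 \<and> j = k - 1 then \<alpha> k
     else if i = k - 1 \<and> j = k then \<beta> k
     else if i = k \<and> j = k - 1 then \<gamma> k
     else if i = k \<and> j = k then \<delta> k
     else if i = j then 1 else 0)"
proof -
  define B where "B = mat_of_rows_list 2 [[\<alpha> k, \<beta> k], [\<gamma> k, \<delta> k]]"
  have B: "dim_row B = 2" "dim_col B = 2"
    "B $$ (0, 0) = \<alpha> k" "B $$ (0, 1) = \<beta> k" "B $$ (1, 0) = \<gamma> k" "B $$ (1, 1) = \<delta> k"
    by (simp_all add: B_def mat_of_rows_list_def)
  obtain p where k: "k = p + 1" using assms(1) by (metis add.commute le_Suc_ex)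
  obtain q where n: "n = p + 1 + q" using assms(2) k by (metis le_Suc_ex)
  define C where "C = four_block_mat B (0\<^sub>m 2 q) (0\<^sub>m q 2) (1\<^sub>m q)"
  have C_dim: "dim_row C = 2 + q" "dim_col C = 2 + q"
    by (simp_all add: C_def B)
  have C: "C $$ (a, b) = (if a < 2 then if b < 2 then B $$ (a, b) else 0 else if a = b then 1 else 0)"
    if "a < 2 + q" "b < 2 + q" for a b
    unfolding C_def using that B(1,2) by (subst index_mat_four_block) auto
  have G: "G_mat n \<alpha> \<beta> \<gamma> \<delta> k = four_block_mat (1\<^sub>m p) (0\<^sub>m p (2 + q)) (0\<^sub>m (2 + q) p) C"
  proof -
    have "four_block_mat (1\<^sub>m q) (0\<^sub>m q 0) (0\<^sub>m 0 q) (0\<^sub>m 0 0) = (1\<^sub>m q :: complex mat)"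
      by (rule eq_matI) auto
    then show ?thesis
      unfolding G_mat_def B_def[symmetric] by (simp add: k n Let_def B C_def)
  qed
  have "G_mat n \<alpha> \<beta> \<gamma> \<delta> k $$ (i, j) =
    (if i < p then if i = j then 1 else 0 else if j < p then 0 else C $$ (i - p, j - p))"
    unfolding G using assms(3,4) C_dim n by (subst index_mat_four_block) auto
  moreover have "i < p \<or> i = p \<or> i = p + 1 \<or> \<not> i < p + 2"
    "j < p \<or> j = p \<or> j = p + 1 \<or> \<not> j < p + 2" by linarith+
  moreover have "\<not> i < p \<Longrightarrow> \<not> j < p \<Longrightarrow> C $$ (i - p, j - p) =
      (if i - p < 2 then if j - p < 2 then B $$ (i - p, j - p) else 0 else if i - p = j - p then 1 else 0)"
    by (rule C) (use assms(3,4) n in linarith)+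
  ultimately show ?thesis
    unfolding k using B(3-6)[unfolded k] by (elim disjE) auto
qed

end

theory Submission
  imports Defs
begin

text \<open>The proof is an induction on \<open>n\<close> that peels off the last matrix \<open>G (n + 1)\<close>. This matrix
  commutes with every \<open>G k\<close> for \<open>k < n\<close>, so only its position relative to \<open>G n\<close> matters: if \<open>G n\<close>
  stands to its left, it can be moved to the right end of the product, and otherwise to the left
  end (\<open>word_prod_remove_last\<close>). The other factors multiply to \<open>N \<oplus> 1\<close>, where \<open>N\<close> is the product
  of the smaller matrices \<open>G 1, \<dots>, G n\<close> in the same order.

  It therefore remains to compare \<open>(N \<oplus> 1) * G (n + 1)\<close> with \<open>G (n + 1) * (N \<oplus> 1)\<close>. Write
  \<open>A = A' \<oplus> (a)\<close> and \<open>D = D' \<oplus> (d)\<close>, and let \<open>\<alpha>, \<beta>, \<gamma>, \<delta>\<close> be the entries of \<open>G (n + 1)\<close>. In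
  the first case, expand \<open>A (N \<oplus> 1) G + D\<close> along its last row, which has only the two nonzero
  entries \<open>a \<gamma>\<close> and \<open>a \<delta> + d\<close>. The two minors differ from \<open>A' N + D'\<close> in the last column only,
  and a determinant is linear in its last column. With \<open>R = det (A' N + D')\<close> and with \<open>P\<close> the same
  determinant after the last entry of \<open>D'\<close> has been replaced by \<open>0\<close>, the result is
  \<open>(a \<delta> + d) (\<alpha> P + (R - P)) - a \<beta> \<gamma> P\<close>. The second case is the same computation for the
  transposed matrix and gives the same value (\<open>det_ampd_mult_last\<close>, \<open>det_ampd_last_mult\<close>). Both \<open>P\<close>
  and \<open>R\<close> are determinants of the smaller problem, with the same \<open>A'\<close> and two choices of \<open>D'\<close>, so
  by induction they do not depend on the order of the factors of \<open>N\<close>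
  (\<open>det_ampd_word_prod_cong\<close>).

  The statements on eigenvalues follow from the one on determinants: the characteristic polynomial
  of \<open>A M + D\<close> takes at \<open>z\<close> the value \<open>det ((-A) M + (z I - D))\<close>, again a determinant of the same
  kind, and a complex polynomial is determined by its values.\<close>

section \<open>Determinants with a prescribed last column\<close>

definition set_last_col :: "nat \<Rightarrow> 'a mat \<Rightarrow> (nat \<Rightarrow> 'a) \<Rightarrow> 'a mat" where
  "set_last_col m T v = mat (Suc m) (Suc m) (\<lambda>(i, j). if j = m then v i else T $$ (i, j))"

lemma set_last_col_carrier [simp]: "set_last_col m T v \<in> carrier_mat (Suc m) (Suc m)"
  by (simp add: set_last_col_def)

text \<open>The cofactors along the last column do not involve that column; filling it with zeros makes
  this visible, and linearity in the column follows.\<close>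

lemma det_set_last_col:
  "det (set_last_col m T v)
    = (\<Sum>i<Suc m. v i * cofactor (set_last_col m T (\<lambda>_. 0)) i m)"
  for v :: "nat \<Rightarrow> 'a :: comm_ring_1"
proof -
  have "mat_delete (set_last_col m T v) i m = mat_delete (set_last_col m T (\<lambda>_. 0)) i m" for i
    by (rule eq_matI) (auto simp: set_last_col_def mat_delete_def)
  then have "cofactor (set_last_col m T v) i m = cofactor (set_last_col m T (\<lambda>_. 0)) i m" for i
    by (simp add: cofactor_def)
  moreover have "set_last_col m T v $$ (i, m) = v i" if "i < Suc m" for i
    using that by (simp add: set_last_col_def)
  ultimately show ?thesis
    by (subst laplace_expansion_column[of _ "Suc m" m]) (auto intro!: sum.cong)
qed

lemma det_set_last_col_linear:
  fixes u v :: "nat \<Rightarrow> 'a :: comm_ring_1"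
  shows "det (set_last_col m T (\<lambda>i. x * u i + y * v i))
    = x * det (set_last_col m T u) + y * det (set_last_col m T v)"
  unfolding det_set_last_col[of m T "\<lambda>i. x * u i + y * v i"] det_set_last_col[of m T u]
    det_set_last_col[of m T v]
  by (simp only: sum_distrib_left sum.distrib[symmetric] distrib_right mult.assoc)

text \<open>Laplace expansion along a last row with at most two nonzero entries. Deleting the last column
  leaves \<open>c\<close> as the final column of the minor, and deleting the one before it leaves \<open>v\<close>.\<close>

lemma det_bordered:
  fixes W :: "'a :: comm_ring_1 mat"
  assumes W: "W \<in> carrier_mat (Suc (Suc m)) (Suc (Suc m))"
    and row: "\<And>j. j < m \<Longrightarrow> W $$ (Suc m, j) = 0"
    and block: "\<And>i j. i < Suc m \<Longrightarrow> j < m \<Longrightarrow> W $$ (i, j) = T $$ (i, j)"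
    and c: "\<And>i. i < Suc m \<Longrightarrow> W $$ (i, m) = c i"
    and v: "\<And>i. i < Suc m \<Longrightarrow> W $$ (i, Suc m) = v i"
  shows "det W = W $$ (Suc m, Suc m) * det (set_last_col m T c)
    - W $$ (Suc m, m) * det (set_last_col m T v)"
proof -
  have "mat_delete W (Suc m) (Suc m) = set_last_col m T c"
    using W block c by (intro eq_matI) (auto simp: set_last_col_def mat_delete_def)
  moreover have "mat_delete W (Suc m) m = set_last_col m T v"
    using W block v by (intro eq_matI) (auto simp: set_last_col_def mat_delete_def)
  ultimately show ?thesis
    using row by (subst laplace_expansion_row[OF W, of "Suc m"]) (auto simp: cofactor_def)
qed

text \<open>The form shared by both positions of the last factor. The last two columns are, up to the
  diagonal contribution \<open>e\<close>, multiples of one vector \<open>w\<close>. The scalar \<open>\<kappa>\<close> is split off so that no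
  division is needed: for a factor on the left, \<open>\<kappa>\<close> is a diagonal entry of \<open>A\<close> that may
  vanish, and it occurs in the column \<open>\<kappa> w\<close> and in the last row but not in the column \<open>y w\<close>.\<close>

lemma det_bordered_update:
  fixes W :: "'a :: comm_ring_1 mat"
  assumes W: "W \<in> carrier_mat (Suc (Suc m)) (Suc (Suc m))"
    and row: "\<And>j. j < m \<Longrightarrow> W $$ (Suc m, j) = 0" "W $$ (Suc m, m) = q * \<kappa>" "W $$ (Suc m, Suc m) = s"
    and block: "\<And>i j. i < Suc m \<Longrightarrow> j < m \<Longrightarrow> W $$ (i, j) = T $$ (i, j)"
    and c: "\<And>i. i < Suc m \<Longrightarrow> W $$ (i, m) = x * (\<kappa> * w i) + e i"
    and v: "\<And>i. i < Suc m \<Longrightarrow> W $$ (i, Suc m) = y * w i"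
  defines "P \<equiv> det (set_last_col m T (\<lambda>i. \<kappa> * w i))"
    and "R \<equiv> det (set_last_col m T (\<lambda>i. \<kappa> * w i + e i))"
  shows "det W = s * (x * P + (R - P)) - q * y * P"
proof -
  have P: "P = \<kappa> * det (set_last_col m T w)"
    using det_set_last_col_linear[of m T \<kappa> w 0 e] by (simp add: P_def)
  have R: "R = P + det (set_last_col m T e)"
    using det_set_last_col_linear[of m T 1 "\<lambda>i. \<kappa> * w i" 1 e] by (simp add: R_def P_def)
  have "det (set_last_col m T (\<lambda>i. x * (\<kappa> * w i) + e i)) = x * P + det (set_last_col m T e)"
    using det_set_last_col_linear[of m T x "\<lambda>i. \<kappa> * w i" 1 e] by (simp add: P_def)
  moreover have "det (set_last_col m T (\<lambda>i. y * w i)) = y * det (set_last_col m T w)"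
    using det_set_last_col_linear[of m T y w 0 e] by simp
  ultimately show ?thesis
    by (simp add: det_bordered[OF W row(1) block c v] row P R algebra_simps)
qed

section \<open>Products of matrices along a word\<close>

definition word_prod :: "nat \<Rightarrow> ('i \<Rightarrow> 'a :: semiring_1 mat) \<Rightarrow> 'i list \<Rightarrow> 'a mat" where
  "word_prod N G ws = foldr (\<lambda>k P. G k * P) ws (1\<^sub>m N)"

lemma word_prod_simps [simp]:
  "word_prod N G [] = 1\<^sub>m N"
  "word_prod N G (w # ws) = G w * word_prod N G ws"
  by (simp_all add: word_prod_def)

lemma word_prod_carrier:
  "(\<And>k. k \<in> set ws \<Longrightarrow> G k \<in> carrier_mat N N) \<Longrightarrow> word_prod N G ws \<in> carrier_mat N N"
  by (induction ws) (auto intro: mult_carrier_mat)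

lemma word_prod_append:
  assumes "\<And>k. k \<in> set (us @ ws) \<Longrightarrow> G k \<in> carrier_mat N N"
  shows "word_prod N G (us @ ws) = word_prod N G us * word_prod N G ws"
  using assms
proof (induction us)
  case Nil
  then show ?case using word_prod_carrier[of ws G N] by simp
next
  case (Cons k us)
  then have "G k \<in> carrier_mat N N" "word_prod N G us \<in> carrier_mat N N"
    "word_prod N G ws \<in> carrier_mat N N"
    by (auto intro!: word_prod_carrier)
  with Cons show ?case by (simp add: assoc_mult_mat[of _ N N _ N _ N])
qed

abbreviation pad :: "nat \<Rightarrow> nat \<Rightarrow> 'a :: semiring_1 mat \<Rightarrow> 'a mat" where
  "pad p q X \<equiv> four_block_mat X (0\<^sub>m p q) (0\<^sub>m q p) (1\<^sub>m q)"

lemma word_prod_pad: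
  assumes "\<And>k. k \<in> set ws \<Longrightarrow> H k \<in> carrier_mat p p"
    and "\<And>k. k \<in> set ws \<Longrightarrow> G k = pad p q (H k)"
  shows "word_prod (p + q) G ws = pad p q (word_prod p H ws)"
  using assms
proof (induction ws)
  case Nil
  then show ?case by (auto intro!: eq_matI)
next
  case (Cons k ws)
  have H: "H k \<in> carrier_mat p p" "word_prod p H ws \<in> carrier_mat p p"
    using Cons.prems by (auto intro!: word_prod_carrier)
  then show ?case
    using Cons by (simp add: mult_four_block_mat[of _ p p _ q _ q _ _ p _ q]
      right_mult_zero_mat[OF H(1)] right_add_zero_mat[OF mult_carrier_mat[OF H]])
qed

text \<open>Block-diagonal matrices commute as soon as in each block one of the two is the identity.\<close>

lemma diagonal_blocks_commute:
  assumes "X \<in> carrier_mat p p" "B \<in> carrier_mat q q"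
  shows "pad p q X * four_block_mat (1\<^sub>m p) (0\<^sub>m p q) (0\<^sub>m q p) B
    = four_block_mat (1\<^sub>m p) (0\<^sub>m p q) (0\<^sub>m q p) B * pad p q X"
  using assms by (simp add: mult_four_block_mat[of _ p p _ q _ q _ _ p _ q])

section \<open>The last factor\<close>

lemma G_mat_pad:
  assumes "1 \<le> k" "k \<le> p"
  shows "G_mat (p + q) \<alpha> \<beta> \<gamma> \<delta> k = pad (p + 1) q (G_mat p \<alpha> \<beta> \<gamma> \<delta> k)"
proof -
  note carr = G_mat_carrier[OF assms, of \<alpha> \<beta> \<gamma> \<delta>]
    G_mat_carrier[of k "p + q" \<alpha> \<beta> \<gamma> \<delta>]
  show ?thesis
    using assms carr by (intro eq_matI) (auto simp: G_mat_index)
qed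

lemma G_mat_last:
  "G_mat (Suc p) \<alpha> \<beta> \<gamma> \<delta> (Suc p) = four_block_mat (1\<^sub>m p) (0\<^sub>m p 2) (0\<^sub>m 2 p)
    (mat_of_rows_list 2 [[\<alpha> (Suc p), \<beta> (Suc p)], [\<gamma> (Suc p), \<delta> (Suc p)]])"
proof -
  define B where "B = mat_of_rows_list 2 [[\<alpha> (Suc p), \<beta> (Suc p)], [\<gamma> (Suc p), \<delta> (Suc p)]]"
  have B: "dim_row B = 2" "dim_col B = 2" by (simp_all add: B_def mat_of_rows_list_def)
  have "pad 2 0 B = B" using B by (intro eq_matI) auto
  moreover have "four_block_mat (1\<^sub>m 0) (0\<^sub>m 0 0) (0\<^sub>m 0 0) (0\<^sub>m 0 0) = (1\<^sub>m 0 :: complex mat)"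
    by (intro eq_matI) auto
  ultimately show ?thesis
    unfolding G_mat_def B_def[symmetric] by (simp add: Let_def B)
qed

text \<open>The factors \<open>G k\<close> with \<open>k < n\<close> act on the first \<open>n\<close> coordinates only, and \<open>G (n + 1)\<close> on the last
  two of the \<open>n + 2\<close> coordinates only.\<close>

lemma G_mat_last_commute:
  assumes "set ws \<subseteq> {1..<n}"
  shows "word_prod (n + 2) (G_mat (Suc n) \<alpha> \<beta> \<gamma> \<delta>) ws * G_mat (Suc n) \<alpha> \<beta> \<gamma> \<delta> (Suc n)
    = G_mat (Suc n) \<alpha> \<beta> \<gamma> \<delta> (Suc n) * word_prod (n + 2) (G_mat (Suc n) \<alpha> \<beta> \<gamma> \<delta>) ws"
proof (cases n)
  case 0
  with assms show ?thesis
    using G_mat_carrier[of 1 1 \<alpha> \<beta> \<gamma> \<delta>] by (simp add: numeral_2_eq_2)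
next
  case (Suc p)
  have H: "G_mat p \<alpha> \<beta> \<gamma> \<delta> k \<in> carrier_mat (p + 1) (p + 1)"
    "G_mat (Suc n) \<alpha> \<beta> \<gamma> \<delta> k = pad (p + 1) 2 (G_mat p \<alpha> \<beta> \<gamma> \<delta> k)" if "k \<in> set ws" for k
  proof -
    have k: "1 \<le> k" "k \<le> p" using that assms Suc by auto
    show "G_mat p \<alpha> \<beta> \<gamma> \<delta> k \<in> carrier_mat (p + 1) (p + 1)"
      by (rule G_mat_carrier[OF k])
    show "G_mat (Suc n) \<alpha> \<beta> \<gamma> \<delta> k = pad (p + 1) 2 (G_mat p \<alpha> \<beta> \<gamma> \<delta> k)"
      using G_mat_pad[OF k, of 2] Suc by simp
  qed
  have "word_prod (p + 1 + 2) (G_mat (Suc n) \<alpha> \<beta> \<gamma> \<delta>) ws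
      = pad (p + 1) 2 (word_prod (p + 1) (G_mat p \<alpha> \<beta> \<gamma> \<delta>) ws)"
    by (rule word_prod_pad) (use H in auto)
  then have W: "word_prod (n + 2) (G_mat (Suc n) \<alpha> \<beta> \<gamma> \<delta>) ws
      = pad n 2 (word_prod n (G_mat p \<alpha> \<beta> \<gamma> \<delta>) ws)"
    using Suc by simp
  have "word_prod n (G_mat p \<alpha> \<beta> \<gamma> \<delta>) ws \<in> carrier_mat n n"
    by (rule word_prod_carrier) (use H Suc in auto)
  then show ?thesis
    unfolding W G_mat_last by (rule diagonal_blocks_commute) (auto simp: mat_of_rows_list_def)
qed

text \<open>Since \<open>n\<close> occurs only once in the word, it is missing on at least one side of the letter
  \<open>n + 1\<close>, and \<open>G (n + 1)\<close> can be moved out across that side.\<close>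

lemma word_prod_remove_last:
  assumes "distinct ws" "set ws = {1..Suc n}"
  obtains vs where "distinct vs" "set vs = {1..n}"
    "word_prod (n + 2) (G_mat (Suc n) \<alpha> \<beta> \<gamma> \<delta>) ws
        = pad (n + 1) 1 (word_prod (n + 1) (G_mat n \<alpha> \<beta> \<gamma> \<delta>) vs) * G_mat (Suc n) \<alpha> \<beta> \<gamma> \<delta> (Suc n)
      \<or> word_prod (n + 2) (G_mat (Suc n) \<alpha> \<beta> \<gamma> \<delta>) ws
        = G_mat (Suc n) \<alpha> \<beta> \<gamma> \<delta> (Suc n) * pad (n + 1) 1 (word_prod (n + 1) (G_mat n \<alpha> \<beta> \<gamma> \<delta>) vs)"
proof -
  let ?G = "G_mat (Suc n) \<alpha> \<beta> \<gamma> \<delta>"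
  let ?W = "word_prod (n + 2) ?G"
  have "Suc n \<in> set ws" using assms by simp
  then obtain us zs where ws: "ws = us @ Suc n # zs"
    by (auto dest: split_list)
  have dist: "distinct (us @ zs)" and notin: "Suc n \<notin> set (us @ zs)"
    using assms(1) ws by auto
  have set_vs: "set (us @ zs) = {1..n}"
  proof -
    have "insert (Suc n) (set (us @ zs)) = {1..Suc n}" using assms(2) ws by auto
    then have "set (us @ zs) = {1..Suc n} - {Suc n}" using notin by blast
    also have "\<dots> = {1..n}" by auto
    finally show ?thesis .
  qed
  have Gc: "?G k \<in> carrier_mat (n + 2) (n + 2)" if "1 \<le> k" "k \<le> Suc n" for k
    using G_mat_carrier[OF that] by simp
  have sub: "set us \<subseteq> {1..n}" "set zs \<subseteq> {1..n}" using set_vs by auto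
  have Gc': "?G k \<in> carrier_mat (n + 2) (n + 2)" if "k \<in> set us \<or> k \<in> set zs \<or> k = Suc n" for k
    using that sub by (intro Gc) auto
  have carr: "?W us \<in> carrier_mat (n + 2) (n + 2)" "?W zs \<in> carrier_mat (n + 2) (n + 2)"
    by (rule word_prod_carrier, rule Gc', simp)+
  have G: "?G (Suc n) \<in> carrier_mat (n + 2) (n + 2)" using Gc by simp
  have W_ws: "?W ws = ?W us * (?G (Suc n) * ?W zs)"
    unfolding ws by (subst word_prod_append, rule Gc') auto
  have W_vs: "?W (us @ zs) = ?W us * ?W zs"
    by (rule word_prod_append, rule Gc') auto
  have "word_prod (n + 1 + 1) ?G (us @ zs)
      = pad (n + 1) 1 (word_prod (n + 1) (G_mat n \<alpha> \<beta> \<gamma> \<delta>) (us @ zs))"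
  proof (rule word_prod_pad)
    fix k assume "k \<in> set (us @ zs)"
    then have k: "1 \<le> k" "k \<le> n" using set_vs by auto
    show "G_mat n \<alpha> \<beta> \<gamma> \<delta> k \<in> carrier_mat (n + 1) (n + 1)"
      by (rule G_mat_carrier[OF k])
    show "?G k = pad (n + 1) 1 (G_mat n \<alpha> \<beta> \<gamma> \<delta> k)"
      using G_mat_pad[OF k, of 1] by simp
  qed
  then have pad_vs: "?W (us @ zs) = pad (n + 1) 1 (word_prod (n + 1) (G_mat n \<alpha> \<beta> \<gamma> \<delta>) (us @ zs))"
    by (simp add: numeral_2_eq_2)
  have "n \<notin> set us \<or> n \<notin> set zs" using dist by auto
  then have "?W ws = ?W (us @ zs) * ?G (Suc n) \<or> ?W ws = ?G (Suc n) * ?W (us @ zs)"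
  proof
    assume "n \<notin> set us"
    with sub have "set us \<subseteq> {1..<n}" by (auto simp: order.order_iff_strict)
    from G_mat_last_commute[OF this, of \<alpha> \<beta> \<gamma> \<delta>] show ?thesis
      unfolding W_ws W_vs using carr G by (simp only: simp_thms flip: assoc_mult_mat[of _ "n + 2" "n + 2" _ "n + 2" _ "n + 2"])
  next
    assume "n \<notin> set zs"
    with sub have "set zs \<subseteq> {1..<n}" by (auto simp: order.order_iff_strict)
    from G_mat_last_commute[OF this, of \<alpha> \<beta> \<gamma> \<delta>] show ?thesis
      unfolding W_ws W_vs using carr G by (simp only: simp_thms assoc_mult_mat[of _ "n + 2" "n + 2" _ "n + 2" _ "n + 2"])
  qed
  then show ?thesis
    using that[OF dist set_vs] unfolding pad_vs by blast
qed

text \<open>Multiplication by the last factor mixes the last two columns or rows and fixes all others.\<close>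

lemma mult_G_mat_last_index:
  assumes "X \<in> carrier_mat (Suc (Suc m)) (Suc (Suc m))" "i < Suc (Suc m)" "j < Suc (Suc m)"
  shows "(X * G_mat (Suc m) \<alpha> \<beta> \<gamma> \<delta> (Suc m)) $$ (i, j) =
    (if j < m then X $$ (i, j)
     else if j = m then \<alpha> (Suc m) * X $$ (i, m) + \<gamma> (Suc m) * X $$ (i, Suc m)
     else \<beta> (Suc m) * X $$ (i, m) + \<delta> (Suc m) * X $$ (i, Suc m))"
proof -
  let ?G = "G_mat (Suc m) \<alpha> \<beta> \<gamma> \<delta> (Suc m)"
  have G: "?G \<in> carrier_mat (Suc (Suc m)) (Suc (Suc m))"
    using G_mat_carrier[of "Suc m" "Suc m"] by simp
  have "(X * ?G) $$ (i, j) = (\<Sum>k = 0..<Suc (Suc m). X $$ (i, k) * ?G $$ (k, j))"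
    using assms G by (auto simp: scalar_prod_def intro!: sum.cong)
  also have "\<dots> = (\<Sum>k = 0..<m. if k = j then X $$ (i, j) else 0)
      + X $$ (i, m) * ?G $$ (m, j) + X $$ (i, Suc m) * ?G $$ (Suc m, j)"
  proof -
    have "(\<Sum>k = 0..<m. X $$ (i, k) * ?G $$ (k, j)) = (\<Sum>k = 0..<m. if k = j then X $$ (i, j) else 0)"
      using assms(3) by (intro sum.cong) (auto simp: G_mat_index)
    then show ?thesis by simp
  qed
  finally show ?thesis
    using assms(3) by (auto simp: G_mat_index algebra_simps)
qed

lemma G_mat_last_mult_index:
  assumes "X \<in> carrier_mat (Suc (Suc m)) (Suc (Suc m))" "i < Suc (Suc m)" "j < Suc (Suc m)"
  shows "(G_mat (Suc m) \<alpha> \<beta> \<gamma> \<delta> (Suc m) * X) $$ (i, j) =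
    (if i < m then X $$ (i, j)
     else if i = m then \<alpha> (Suc m) * X $$ (m, j) + \<beta> (Suc m) * X $$ (Suc m, j)
     else \<gamma> (Suc m) * X $$ (m, j) + \<delta> (Suc m) * X $$ (Suc m, j))"
proof -
  let ?G = "G_mat (Suc m) \<alpha> \<beta> \<gamma> \<delta> (Suc m)"
  have G: "?G \<in> carrier_mat (Suc (Suc m)) (Suc (Suc m))"
    using G_mat_carrier[of "Suc m" "Suc m"] by simp
  have "(?G * X) $$ (i, j) = (\<Sum>k = 0..<Suc (Suc m). ?G $$ (i, k) * X $$ (k, j))"
    using assms G by (auto simp: scalar_prod_def intro!: sum.cong)
  also have "\<dots> = (\<Sum>k = 0..<m. if k = i then X $$ (i, j) else 0)
      + ?G $$ (i, m) * X $$ (m, j) + ?G $$ (i, Suc m) * X $$ (Suc m, j)"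
  proof -
    have "(\<Sum>k = 0..<m. ?G $$ (i, k) * X $$ (k, j)) = (\<Sum>k = 0..<m. if k = i then X $$ (i, j) else 0)"
      using assms(2) by (intro sum.cong) (auto simp: G_mat_index)
    then show ?thesis by simp
  qed
  finally show ?thesis
    using assms(2) by (auto simp: G_mat_index algebra_simps)
qed

section \<open>The determinant and the last factor\<close>

definition ampd :: "nat \<Rightarrow> (nat \<Rightarrow> 'a :: semiring_0) \<Rightarrow> (nat \<Rightarrow> 'a) \<Rightarrow> 'a mat \<Rightarrow> 'a mat" where
  "ampd N a d X = mat_diag N a * X + mat_diag N d"

lemma ampd_carrier [simp]: "ampd N a d X \<in> carrier_mat N N"
  by (simp add: ampd_def)

lemma ampd_dim [simp]: "dim_row (ampd N a d X) = N" "dim_col (ampd N a d X) = N"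
  using ampd_carrier[of N a d X] by (simp_all only: carrier_matD)

lemma ampd_index:
  assumes "X \<in> carrier_mat N N" "i < N" "j < N"
  shows "ampd N a d X $$ (i, j) = a i * X $$ (i, j) + (if i = j then d j else 0)"
  using assms by (simp add: ampd_def mat_diag_mult_left) (simp add: mat_diag_def)

text \<open>With the last factor on the right, the last row of the matrix is \<open>(0, \<dots>, 0, a \<gamma>, a \<delta> + d)\<close>,
  and the column that the last factor rescales is the last column of \<open>A' N\<close>.\<close>

lemma det_ampd_mult_last:
  fixes a d \<alpha> \<beta> \<gamma> \<delta> :: "nat \<Rightarrow> complex"
  assumes N: "N \<in> carrier_mat (Suc m) (Suc m)"
  defines "G \<equiv> G_mat (Suc m) \<alpha> \<beta> \<gamma> \<delta> (Suc m)"
    and "R \<equiv> det (ampd (Suc m) a d N)" and "P \<equiv> det (ampd (Suc m) a (d(m := 0)) N)"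
  shows "det (ampd (Suc (Suc m)) a d (pad (Suc m) 1 N * G))
    = (a (Suc m) * \<delta> (Suc m) + d (Suc m)) * (\<alpha> (Suc m) * P + (R - P))
      - a (Suc m) * \<gamma> (Suc m) * \<beta> (Suc m) * P"
proof -
  define X where "X = pad (Suc m) 1 N"
  let ?T = "ampd (Suc m) a d N"
  let ?W = "ampd (Suc (Suc m)) a d (X * G)"
  have X: "X \<in> carrier_mat (Suc (Suc m)) (Suc (Suc m))"
    unfolding X_def using four_block_carrier_mat[OF N one_carrier_mat[of 1]] by simp
  have G: "G \<in> carrier_mat (Suc (Suc m)) (Suc (Suc m))"
    unfolding G_def using G_mat_carrier[of "Suc m" "Suc m"] by simp
  have Y: "X * G \<in> carrier_mat (Suc (Suc m)) (Suc (Suc m))" using X G by simp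
  have W_index: "?W $$ (i, j) = a i * (if j < m then X $$ (i, j)
     else if j = m then \<alpha> (Suc m) * X $$ (i, m) + \<gamma> (Suc m) * X $$ (i, Suc m)
     else \<beta> (Suc m) * X $$ (i, m) + \<delta> (Suc m) * X $$ (i, Suc m)) + (if i = j then d j else 0)"
    if "i < Suc (Suc m)" "j < Suc (Suc m)" for i j
    unfolding ampd_index[OF Y that] unfolding G_def mult_G_mat_last_index[OF X that] ..
  have X_index: "X $$ (i, j) = (if i < Suc m \<and> j < Suc m then N $$ (i, j) else if i = j then 1 else 0)"
    if "i < Suc (Suc m)" "j < Suc (Suc m)" for i j
    using that N by (auto simp: X_def)
  let ?u = "\<lambda>i. a i * N $$ (i, m)" and ?e = "\<lambda>i. if i = m then d m else 0"
  have R: "det (set_last_col m ?T (\<lambda>i. 1 * ?u i + ?e i)) = R"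
    unfolding R_def using N
    by (intro arg_cong[of _ _ det] eq_matI) (auto simp: set_last_col_def ampd_index)
  have P: "det (set_last_col m ?T (\<lambda>i. 1 * ?u i)) = P"
    unfolding P_def using N
    by (intro arg_cong[of _ _ det] eq_matI) (auto simp: set_last_col_def ampd_index)
  show ?thesis
    unfolding X_def[symmetric] R[symmetric] P[symmetric]
    by (rule det_bordered_update)
      (use N in \<open>auto simp: W_index X_index ampd_index\<close>)
qed

text \<open>With the last factor on the left, the matrix has a sparse last column instead of a sparse last
  row, so the expansion is applied to the transpose. The rescaled column is then
  \<open>\<kappa> w\<close>, where \<open>w\<close> is the last row of \<open>N\<close> and \<open>\<kappa> = a m\<close>.\<close>

lemma det_ampd_last_mult:
  fixes a d \<alpha> \<beta> \<gamma> \<delta> :: "nat \<Rightarrow> complex"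
  assumes N: "N \<in> carrier_mat (Suc m) (Suc m)"
  defines "G \<equiv> G_mat (Suc m) \<alpha> \<beta> \<gamma> \<delta> (Suc m)"
    and "R \<equiv> det (ampd (Suc m) a d N)" and "P \<equiv> det (ampd (Suc m) a (d(m := 0)) N)"
  shows "det (ampd (Suc (Suc m)) a d (G * pad (Suc m) 1 N))
    = (a (Suc m) * \<delta> (Suc m) + d (Suc m)) * (\<alpha> (Suc m) * P + (R - P))
      - a (Suc m) * \<gamma> (Suc m) * \<beta> (Suc m) * P"
proof -
  define X where "X = pad (Suc m) 1 N"
  let ?T = "ampd (Suc m) a d N"
  let ?W = "ampd (Suc (Suc m)) a d (G * X)"
  have X: "X \<in> carrier_mat (Suc (Suc m)) (Suc (Suc m))"
    unfolding X_def using four_block_carrier_mat[OF N one_carrier_mat[of 1]] by simp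
  have G: "G \<in> carrier_mat (Suc (Suc m)) (Suc (Suc m))"
    unfolding G_def using G_mat_carrier[of "Suc m" "Suc m"] by simp
  have Y: "G * X \<in> carrier_mat (Suc (Suc m)) (Suc (Suc m))" using X G by simp
  have W_index: "?W $$ (i, j) = a i * (if i < m then X $$ (i, j)
     else if i = m then \<alpha> (Suc m) * X $$ (m, j) + \<beta> (Suc m) * X $$ (Suc m, j)
     else \<gamma> (Suc m) * X $$ (m, j) + \<delta> (Suc m) * X $$ (Suc m, j)) + (if i = j then d j else 0)"
    if "i < Suc (Suc m)" "j < Suc (Suc m)" for i j
    unfolding ampd_index[OF Y that] unfolding G_def G_mat_last_mult_index[OF X that] ..
  have X_index: "X $$ (i, j) = (if i < Suc m \<and> j < Suc m then N $$ (i, j) else if i = j then 1 else 0)"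
    if "i < Suc (Suc m)" "j < Suc (Suc m)" for i j
    using that N by (auto simp: X_def)
  let ?u = "\<lambda>i. a m * N $$ (m, i)" and ?e = "\<lambda>i. if i = m then d m else 0"
  have "set_last_col m ?T\<^sup>T (\<lambda>i. ?u i + ?e i) = ?T\<^sup>T"
    using N by (intro eq_matI) (auto simp: set_last_col_def ampd_index)
  then have R: "det (set_last_col m ?T\<^sup>T (\<lambda>i. ?u i + ?e i)) = R"
    by (simp add: R_def det_transpose[OF ampd_carrier])
  have "set_last_col m ?T\<^sup>T ?u = (ampd (Suc m) a (d(m := 0)) N)\<^sup>T"
    using N by (intro eq_matI) (auto simp: set_last_col_def ampd_index)
  then have P: "det (set_last_col m ?T\<^sup>T ?u) = P"
    by (simp add: P_def det_transpose[OF ampd_carrier])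
  have "det ?W\<^sup>T = (a (Suc m) * \<delta> (Suc m) + d (Suc m)) * (\<alpha> (Suc m) * P + (R - P))
      - \<beta> (Suc m) * (a (Suc m) * \<gamma> (Suc m)) * P"
    unfolding R[symmetric] P[symmetric]
    by (rule det_bordered_update)
      (use N in \<open>auto simp: W_index X_index ampd_index\<close>)
  then show ?thesis
    unfolding X_def by (simp add: det_transpose[OF ampd_carrier] mult_ac)
qed

section \<open>Independence of the order\<close>

text \<open>The induction must range over all \<open>d\<close>, because the recursion uses the smaller determinant
  for \<open>d\<close> and for \<open>d\<close> with its last entry set to \<open>0\<close>.\<close>

lemma det_ampd_word_prod_cong:
  assumes "distinct vs" "set vs = {1..n}" "distinct ws" "set ws = {1..n}"
  shows "det (ampd (n + 1) a d (word_prod (n + 1) (G_mat n \<alpha> \<beta> \<gamma> \<delta>) vs))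
    = det (ampd (n + 1) a d (word_prod (n + 1) (G_mat n \<alpha> \<beta> \<gamma> \<delta>) ws))"
  using assms
proof (induction n arbitrary: vs ws d)
  case 0
  then show ?case by simp
next
  case (Suc n)
  let ?w = "word_prod (n + 1) (G_mat n \<alpha> \<beta> \<gamma> \<delta>)"
  let ?f = "\<lambda>us. (a (Suc n) * \<delta> (Suc n) + d (Suc n))
          * (\<alpha> (Suc n) * det (ampd (Suc n) a (d(n := 0)) (?w us))
            + (det (ampd (Suc n) a d (?w us)) - det (ampd (Suc n) a (d(n := 0)) (?w us))))
        - a (Suc n) * \<gamma> (Suc n) * \<beta> (Suc n) * det (ampd (Suc n) a (d(n := 0)) (?w us))"
  have step: thesis
    if xs: "distinct xs" "set xs = {1..Suc n}"
      and that: "\<And>us. distinct us \<Longrightarrow> set us = {1..n} \<Longrightarrow>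
        det (ampd (Suc n + 1) a d (word_prod (Suc n + 1) (G_mat (Suc n) \<alpha> \<beta> \<gamma> \<delta>) xs)) = ?f us
        \<Longrightarrow> thesis" for xs thesis
  proof -
    from xs obtain us where us: "distinct us" "set us = {1..n}" and
      split: "word_prod (n + 2) (G_mat (Suc n) \<alpha> \<beta> \<gamma> \<delta>) xs
          = pad (n + 1) 1 (?w us) * G_mat (Suc n) \<alpha> \<beta> \<gamma> \<delta> (Suc n)
        \<or> word_prod (n + 2) (G_mat (Suc n) \<alpha> \<beta> \<gamma> \<delta>) xs
          = G_mat (Suc n) \<alpha> \<beta> \<gamma> \<delta> (Suc n) * pad (n + 1) 1 (?w us)"
      by (rule word_prod_remove_last)
    have N: "?w us \<in> carrier_mat (Suc n) (Suc n)"
      using us G_mat_carrier[of _ n \<alpha> \<beta> \<gamma> \<delta>] word_prod_carrier[of us "G_mat n \<alpha> \<beta> \<gamma> \<delta>" "n + 1"] by simp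
    have "det (ampd (Suc (Suc n)) a d (word_prod (n + 2) (G_mat (Suc n) \<alpha> \<beta> \<gamma> \<delta>) xs)) = ?f us"
      using split
    proof
      assume "word_prod (n + 2) (G_mat (Suc n) \<alpha> \<beta> \<gamma> \<delta>) xs
        = pad (n + 1) 1 (?w us) * G_mat (Suc n) \<alpha> \<beta> \<gamma> \<delta> (Suc n)"
      with det_ampd_mult_last[OF N, of a d \<alpha> \<beta> \<gamma> \<delta>] show ?thesis by (simp only: Suc_eq_plus1)
    next
      assume "word_prod (n + 2) (G_mat (Suc n) \<alpha> \<beta> \<gamma> \<delta>) xs
        = G_mat (Suc n) \<alpha> \<beta> \<gamma> \<delta> (Suc n) * pad (n + 1) 1 (?w us)"
      with det_ampd_last_mult[OF N, of a d \<alpha> \<beta> \<gamma> \<delta>] show ?thesis by (simp only: Suc_eq_plus1)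
    qed
    then show ?thesis using that us by simp
  qed
  obtain us where us: "distinct us" "set us = {1..n}"
    "det (ampd (Suc n + 1) a d (word_prod (Suc n + 1) (G_mat (Suc n) \<alpha> \<beta> \<gamma> \<delta>) vs)) = ?f us"
    by (rule step[OF Suc.prems(1,2)])
  obtain us' where us': "distinct us'" "set us' = {1..n}"
    "det (ampd (Suc n + 1) a d (word_prod (Suc n + 1) (G_mat (Suc n) \<alpha> \<beta> \<gamma> \<delta>) ws)) = ?f us'"
    by (rule step[OF Suc.prems(3,4)])
  have "det (ampd (Suc n) a d' (?w us)) = det (ampd (Suc n) a d' (?w us'))" for d'
    using Suc.IH[OF us(1,2) us'(1,2)] by simp
  then show ?case by (simp only: us(3) us'(3))
qed

lemma diagonal_mat_eq_mat_diag:
  assumes "A \<in> carrier_mat N N" "diagonal_mat A"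
  shows "A = mat_diag N (\<lambda>i. A $$ (i, i))"
  using assms by (intro eq_matI) (auto simp: mat_diag_def diagonal_mat_def)

lemma M_mat_word_prod:
  "M_mat n \<alpha> \<beta> \<gamma> \<delta> \<pi> = word_prod (n + 1) (G_mat n \<alpha> \<beta> \<gamma> \<delta>) (map \<pi> [1..<n + 1])"
  by (simp add: M_mat_def word_prod_def foldr_map o_def)

lemma permutes_word:
  assumes "\<pi> permutes {1..n}"
  shows "distinct (map \<pi> [1..<n + 1])" "set (map \<pi> [1..<n + 1]) = {1..n}"
proof -
  have "set [1..<n + 1] = {1..n}" by auto
  then show "distinct (map \<pi> [1..<n + 1])" "set (map \<pi> [1..<n + 1]) = {1..n}"
    using permutes_inj_on[OF assms, of "{1..n}"] permutes_image[OF assms]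
    by (simp_all only: distinct_map distinct_upt set_map simp_thms)
qed

lemma M_mat_carrier:
  assumes "\<pi> permutes {1..n}"
  shows "M_mat n \<alpha> \<beta> \<gamma> \<delta> \<pi> \<in> carrier_mat (n + 1) (n + 1)"
  unfolding M_mat_word_prod
proof (rule word_prod_carrier)
  fix k assume "k \<in> set (map \<pi> [1..<n + 1])"
  then show "G_mat n \<alpha> \<beta> \<gamma> \<delta> k \<in> carrier_mat (n + 1) (n + 1)"
    unfolding permutes_word(2)[OF assms] by (intro G_mat_carrier) auto
qed

lemma det_AMPD_mat_cong:
  assumes "A \<in> carrier_mat (n + 1) (n + 1)" "diagonal_mat A"
    and "D \<in> carrier_mat (n + 1) (n + 1)" "diagonal_mat D"
    and "\<pi> permutes {1..n}" "\<sigma> permutes {1..n}"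
  shows "det (AMPD_mat n A D \<alpha> \<beta> \<gamma> \<delta> \<pi>) = det (AMPD_mat n A D \<alpha> \<beta> \<gamma> \<delta> \<sigma>)"
proof -
  obtain a d where "A = mat_diag (n + 1) a" "D = mat_diag (n + 1) d"
    using diagonal_mat_eq_mat_diag[OF assms(1,2)] diagonal_mat_eq_mat_diag[OF assms(3,4)] by auto
  then show ?thesis
    using det_ampd_word_prod_cong[OF permutes_word[OF assms(5)] permutes_word[OF assms(6)]]
    by (simp only: AMPD_mat_def M_mat_word_prod ampd_def)
qed

text \<open>Equality of polynomials is checked pointwise: at every \<open>z\<close> the value is the determinant of the
  matrix built from the diagonal matrices \<open>- A\<close> and \<open>z I - D\<close>.\<close>

lemma char_poly_AMPD_mat_cong:
  assumes A: "A \<in> carrier_mat (n + 1) (n + 1)" "diagonal_mat A"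
    and D: "D \<in> carrier_mat (n + 1) (n + 1)" "diagonal_mat D"
    and perms: "\<pi> permutes {1..n}" "\<sigma> permutes {1..n}"
  shows "char_poly (AMPD_mat n A D \<alpha> \<beta> \<gamma> \<delta> \<pi>) = char_poly (AMPD_mat n A D \<alpha> \<beta> \<gamma> \<delta> \<sigma>)"
proof -
  have eval: "poly (char_poly (AMPD_mat n A D \<alpha> \<beta> \<gamma> \<delta> \<tau>)) z
      = det (AMPD_mat n (- A) (z \<cdot>\<^sub>m 1\<^sub>m (n + 1) - D) \<alpha> \<beta> \<gamma> \<delta> \<tau>)"
    if "\<tau> permutes {1..n}" for \<tau> z
  proof -
    note M = M_mat_carrier[OF that, of \<alpha> \<beta> \<gamma> \<delta>]
    have X: "AMPD_mat n A D \<alpha> \<beta> \<gamma> \<delta> \<tau> \<in> carrier_mat (n + 1) (n + 1)"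
      using A(1) D(1) M by (simp add: AMPD_mat_def)
    have "- char_matrix (AMPD_mat n A D \<alpha> \<beta> \<gamma> \<delta> \<tau>) z
        = AMPD_mat n (- A) (z \<cdot>\<^sub>m 1\<^sub>m (n + 1) - D) \<alpha> \<beta> \<gamma> \<delta> \<tau>"
      using A(1) D(1) M by (intro eq_matI) (auto simp: AMPD_mat_def char_matrix_def)
    then show ?thesis by (simp only: char_poly_matrix[OF X])
  qed
  have "poly (char_poly (AMPD_mat n A D \<alpha> \<beta> \<gamma> \<delta> \<pi>)) z = poly (char_poly (AMPD_mat n A D \<alpha> \<beta> \<gamma> \<delta> \<sigma>)) z" for z
    unfolding eval[OF perms(1)] eval[OF perms(2)]
    by (rule det_AMPD_mat_cong) (use A D perms in \<open>auto simp: diagonal_mat_def\<close>)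
  then show ?thesis by (simp add: poly_eq_poly_eq_iff[symmetric] fun_eq_iff)
qed

theorem corollary11p4:
  fixes n :: nat
    and \<alpha> \<beta> \<gamma> \<delta> :: "nat \<Rightarrow> complex"
    and A D :: "complex mat"
    and \<pi> \<sigma> :: "nat \<Rightarrow> nat"
  assumes "n \<ge> 1"
    and "A \<in> carrier_mat (n + 1) (n + 1)" and "diagonal_mat A"
    and "D \<in> carrier_mat (n + 1) (n + 1)" and "diagonal_mat D"
    and "\<pi> permutes {1..n}" and "\<sigma> permutes {1..n}"
  shows "det (AMPD_mat n A D \<alpha> \<beta> \<gamma> \<delta> \<pi>) = det (AMPD_mat n A D \<alpha> \<beta> \<gamma> \<delta> \<sigma>)
    \<and> {z. eigenvalue (AMPD_mat n A D \<alpha> \<beta> \<gamma> \<delta> \<pi>) z} = {z. eigenvalue (AMPD_mat n A D \<alpha> \<beta> \<gamma> \<delta> \<sigma>) z}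
    \<and> (\<forall>z. order z (char_poly (AMPD_mat n A D \<alpha> \<beta> \<gamma> \<delta> \<pi>))
           = order z (char_poly (AMPD_mat n A D \<alpha> \<beta> \<gamma> \<delta> \<sigma>)))"
proof -
  have carrier: "AMPD_mat n A D \<alpha> \<beta> \<gamma> \<delta> \<tau> \<in> carrier_mat (n + 1) (n + 1)" if "\<tau> permutes {1..n}" for \<tau>
    using assms(2,4) M_mat_carrier[OF that] by (simp add: AMPD_mat_def)
  show ?thesis
    by (simp only: det_AMPD_mat_cong[OF assms(2-7)] char_poly_AMPD_mat_cong[OF assms(2-7)]
      eigenvalue_root_char_poly[OF carrier[OF assms(6)]] eigenvalue_root_char_poly[OF carrier[OF assms(7)]] simp_thms)
qed

end
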